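(* Let $\mathcal{S}_1,\dots,\mathcal{S}_p$ be linear subspaces of $\mathbb{R}^m$ with $\dim(\mathcal{S}_i) = k_i$, and let $\mathcal{U} = \bigcup_{i=1}^p \mathcal{S}_i$. Let $X \in \mathbb{R}^{m \times N}$ be a matrix all of whose columns lie in $\mathcal{U}$, and suppose the subspaces are independent and $\operatorname{rank}(X) = \sum_{i=1}^p k_i$. Let $S \subset \{1,\dots,N\}$ be such that $X_S$ yields exact matrix recovery, i.e. $X = X_S X_S^{+} X$. Then $X_S$ provides a complete reference set for $\mathcal{U}$.
   Context: For $S \subset \{1,\dots,N\}$, $X_S$ denotes the submatrix of columns of $X$ indexed by $S$, and $X_S^{+}$ denotes its pseudoinverse, so that $X_S X_S^{+}$ is the orthogonal projection onto the span of the columns of $X_S$. The subspaces $\mathcal{S}_1,\dots,\mathcal{S}_p$ are independent if the dimension of their linear span equals $\sum_{i=1}^p k_i$. A matrix $Y$ whose columns lie in $\mathcal{U}$ provides a complete reference set for $\mathcal{U}$ if, for every $i \in \{1,\dots,p\}$, $Y$ contains at least $k_i$ linearly independent columns that lie in $\mathcal{S}_i$ (so that they span $\mathcal{S}_i$). *)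

theory Defs
  imports "Jordan_Normal_Form.DL_Rank_Submatrix" "Jordan_Normal_Form.Gauss_Jordan_Elimination"
begin

text \<open>Column and subspace indices: columns of a matrix are numbered from 0, as in the
  matrix library, and families of subspaces from 1.\<close>

abbreviation real_vs :: "nat \<Rightarrow> (real, real vec) module" where
  "real_vs m \<equiv> module_vec TYPE(real) m"

abbreviation is_subspace :: "nat \<Rightarrow> real vec set \<Rightarrow> bool" where
  "is_subspace m W \<equiv> VectorSpace.subspace class_ring W (real_vs m)"

abbreviation subspace_dim :: "nat \<Rightarrow> real vec set \<Rightarrow> nat" where
  "subspace_dim m W \<equiv> vectorspace.dim class_ring ((real_vs m)\<lparr>carrier := W\<rparr>)"

abbreviation linear_span :: "nat \<Rightarrow> real vec set \<Rightarrow> real vec set" where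
  "linear_span m A \<equiv> LinearCombinations.module.span class_ring (real_vs m) A"

abbreviation linearly_independent :: "nat \<Rightarrow> real vec set \<Rightarrow> bool" where
  "linearly_independent m A \<equiv> LinearCombinations.module.lin_indpt class_ring (real_vs m) A"

definition subspace_union :: "nat \<Rightarrow> (nat \<Rightarrow> real vec set) \<Rightarrow> real vec set" where
  "subspace_union p V = (\<Union>i\<in>{1..p}. V i)"

definition independent_subspaces :: "nat \<Rightarrow> nat \<Rightarrow> (nat \<Rightarrow> real vec set) \<Rightarrow> bool" where
  "independent_subspaces m p V \<longleftrightarrow>
     subspace_dim m (linear_span m (subspace_union p V)) = (\<Sum>i\<in>{1..p}. subspace_dim m (V i))"

definition select_cols :: "'a mat \<Rightarrow> nat set \<Rightarrow> 'a mat" where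
  "select_cols X S = submatrix X UNIV S"

text \<open>Linear independence of the columns is that of the indexed family: \<open>inj_on\<close> excludes
  repeated columns.\<close>

definition complete_reference_set ::
    "nat \<Rightarrow> nat \<Rightarrow> (nat \<Rightarrow> real vec set) \<Rightarrow> real mat \<Rightarrow> bool" where
  "complete_reference_set m p V Y \<longleftrightarrow>
     set (cols Y) \<subseteq> subspace_union p V \<and>
     (\<forall>i\<in>{1..p}. \<exists>J \<subseteq> {0..<dim_col Y}.
        subspace_dim m (V i) \<le> card J \<and>
        inj_on (col Y) J \<and>
        linearly_independent m (col Y ` J) \<and>
        col Y ` J \<subseteq> V i)"

text \<open>The Moore--Penrose pseudoinverse, by the four Penrose equations.\<close>

definition is_pseudoinverse :: "real mat \<Rightarrow> real mat \<Rightarrow> bool" where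
  "is_pseudoinverse A B \<longleftrightarrow>
     B \<in> carrier_mat (dim_col A) (dim_row A) \<and>
     A * B * A = A \<and> B * A * B = B \<and>
     transpose_mat (A * B) = A * B \<and> transpose_mat (B * A) = B * A"

definition pseudoinverse :: "real mat \<Rightarrow> real mat" where
  "pseudoinverse A = (THE B. is_pseudoinverse A B)"

lemma generalized_inverse_exists:
  fixes A :: "'a :: field mat"
  assumes A: "A \<in> carrier_mat m n"
  shows "\<exists>G \<in> carrier_mat n m. A * G * A = A"
proof -
  obtain C where "gauss_jordan_single A = C" by auto
  note gj = gauss_jordan_single[OF A this]
  from gj(2) have C: "C \<in> carrier_mat m n" .
  from gj(4) obtain P Q where CPA: "C = P * A" and P: "P \<in> carrier_mat m m"
    and Q: "Q \<in> carrier_mat m m" and QP: "Q * P = 1\<^sub>m m" by blast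
  from gj(3) C obtain f where piv: "pivot_fun C f n" unfolding row_echelon_form_def by auto
  note pf = pivot_funD[OF carrier_matD(1)[OF C] piv]
  define E :: "'a mat" where
    "E = mat n m (\<lambda>(j, i). if j = f i then 1 else 0)"
  have E: "E \<in> carrier_mat n m" unfolding E_def by simp
  have CE: "(C * E) $$ (i, i') = (if i = i' \<and> f i < n then 1 else 0)"
    if i: "i < m" and i': "i' < m" for i i'
  proof -
    have "(C * E) $$ (i, i') = (\<Sum>j\<in>{0..<n}. C $$ (i, j) * (if j = f i' then 1 else 0))"
      using i i' C unfolding E_def by (simp add: scalar_prod_def)
    also have "\<dots> = (\<Sum>j\<in>{0..<n}. if j = f i' then C $$ (i, j) else 0)"
      by (rule sum.cong) auto
    also have "\<dots> = (if f i' < n then C $$ (i, f i') else 0)"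
      by simp
    also have "\<dots> = (if i = i' \<and> f i < n then 1 else 0)"
      using pf(4)[OF i'] pf(5)[OF i'] i by auto
    finally show ?thesis .
  qed
  have CEC: "C * E * C = C"
  proof (rule eq_matI)
    fix i j assume "i < dim_row C" "j < dim_col C"
    hence i: "i < m" and j: "j < n" using C by auto
    define M where "M = C * E"
    have M: "M \<in> carrier_mat m m" unfolding M_def using C E by simp
    have "(M * C) $$ (i, j) = (\<Sum>k\<in>{0..<m}. M $$ (i, k) * C $$ (k, j))"
      using i j C M by (simp add: scalar_prod_def)
    hence "(C * E * C) $$ (i, j) = (\<Sum>k\<in>{0..<m}. (C * E) $$ (i, k) * C $$ (k, j))"
      unfolding M_def .
    also have "\<dots> = (\<Sum>k\<in>{0..<m}. if k = i then (if f i < n then C $$ (i, j) else 0) else 0)"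
      by (rule sum.cong) (auto simp: CE[OF i])
    also have "\<dots> = (if f i < n then C $$ (i, j) else 0)"
      using i by simp
    also have "\<dots> = C $$ (i, j)"
      using pf(1)[OF i] pf(2)[OF i, of j] j by auto
    finally show "(C * E * C) $$ (i, j) = C $$ (i, j)" .
  qed (use C in auto)
  have AQC: "A = Q * C"
  proof -
    have "Q * C = (Q * P) * A" unfolding CPA by (rule assoc_mult_mat[symmetric, OF Q P A])
    thus ?thesis using QP A by simp
  qed
  have EP: "E * P \<in> carrier_mat n m" using E P by simp
  have "A * (E * P) * A = A * ((E * P) * A)" by (rule assoc_mult_mat[OF A EP A])
  also have "(E * P) * A = E * C" unfolding CPA by (rule assoc_mult_mat[OF E P A])
  also have "A * (E * C) = Q * (C * (E * C))"
    unfolding AQC by (rule assoc_mult_mat[OF Q C]) (use E C in auto)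
  also have "C * (E * C) = C" using CEC assoc_mult_mat[OF C E C] by simp
  finally have "A * (E * P) * A = A" using AQC by simp
  with EP show ?thesis by blast
qed

lemma transpose_mult_self_eq_0D:
  fixes D :: "real mat"
  assumes D: "D \<in> carrier_mat m n" and z: "transpose_mat D * D = 0\<^sub>m n n"
  shows "D = 0\<^sub>m m n"
proof (rule eq_matI)
  fix i j assume "i < dim_row (0\<^sub>m m n :: real mat)" "j < dim_col (0\<^sub>m m n :: real mat)"
  hence i: "i < m" and j: "j < n" by auto
  have "(\<Sum>k\<in>{0..<m}. D $$ (k, j) * D $$ (k, j)) = (transpose_mat D * D) $$ (j, j)"
    using D j by (simp add: scalar_prod_def)
  also have "\<dots> = 0" using z j by simp
  finally have "\<forall>k\<in>{0..<m}. D $$ (k, j) * D $$ (k, j) = 0"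
    by (subst (asm) sum_nonneg_eq_0_iff) auto
  thus "D $$ (i, j) = 0\<^sub>m m n $$ (i, j)" using i j by auto
qed (use D in auto)

lemma gram_cancel:
  fixes A :: "real mat"
  assumes A: "A \<in> carrier_mat m n" and X: "X \<in> carrier_mat n l" and Y: "Y \<in> carrier_mat n l"
    and eq: "transpose_mat A * (A * X) = transpose_mat A * (A * Y)"
  shows "A * X = A * Y"
proof -
  define D where "D = A * X - A * Y"
  have At: "transpose_mat A \<in> carrier_mat n m" using A by simp
  have AX: "A * X \<in> carrier_mat m l" and AY: "A * Y \<in> carrier_mat m l" using A X Y by auto
  have D: "D \<in> carrier_mat m l" unfolding D_def using AX AY by (meson minus_carrier_mat)
  have XY: "X - Y \<in> carrier_mat n l" using Y by (meson minus_carrier_mat)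
  have DA: "D = A * (X - Y)" unfolding D_def by (rule mult_minus_distrib_mat[symmetric, OF A X Y])
  have AtD: "transpose_mat A * D = 0\<^sub>m n l"
    unfolding D_def mult_minus_distrib_mat[OF At AX AY] eq
    by (rule minus_r_inv_mat) (use At AY in auto)
  have "transpose_mat D * D = transpose_mat (X - Y) * transpose_mat A * D"
    unfolding DA using transpose_mult[OF A XY] by simp
  also have "\<dots> = transpose_mat (X - Y) * (transpose_mat A * D)"
    by (rule assoc_mult_mat[OF _ At D]) (use XY in simp)
  also have "\<dots> = 0\<^sub>m l l" unfolding AtD using XY by (intro right_mult_zero_mat) simp
  finally have "D = 0\<^sub>m m l" by (rule transpose_mult_self_eq_0D[OF D])
  hence Z: "A * X - A * Y = 0\<^sub>m m l" unfolding D_def .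
  show ?thesis
  proof (rule eq_matI)
    fix i j assume "i < dim_row (A * Y)" "j < dim_col (A * Y)"
    hence ij: "i < m" "j < l" using AY A Y by auto
    have "(A * X - A * Y) $$ (i, j) = 0" unfolding Z using ij by simp
    moreover have "(A * X - A * Y) $$ (i, j) = (A * X) $$ (i, j) - (A * Y) $$ (i, j)"
      by (rule index_minus_mat) (use ij AY in auto)
    ultimately show "(A * X) $$ (i, j) = (A * Y) $$ (i, j)" by linarith
  qed (use A X Y in auto)
qed

lemma symmetric_projection_exists:
  fixes A :: "real mat"
  assumes A: "A \<in> carrier_mat m n"
  shows "\<exists>G \<in> carrier_mat n m. A * G * A = A \<and> transpose_mat (A * G) = A * G"
proof -
  define At where "At = transpose_mat A"
  have At: "At \<in> carrier_mat n m" unfolding At_def using A by simp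
  define B where "B = At * A"
  have B: "B \<in> carrier_mat n n" unfolding B_def using A At by simp
  obtain G where G: "G \<in> carrier_mat n n" and BGB: "B * G * B = B"
    using generalized_inverse_exists[OF B] by blast
  have GB: "G * B \<in> carrier_mat n n" using G B by simp
  have 1: "A * (G * B) = A * 1\<^sub>m n"
  proof (rule gram_cancel[OF A GB one_carrier_mat], fold At_def)
    have "At * (A * (G * B)) = B * (G * B)" unfolding B_def
      by (rule assoc_mult_mat[symmetric, OF At A]) (use GB B_def in auto)
    also have "\<dots> = B" using BGB assoc_mult_mat[OF B G B] by simp
    finally show "At * (A * (G * B)) = At * (A * 1\<^sub>m n)" using A unfolding B_def by simp
  qed
  define H where "H = G * At"
  have H: "H \<in> carrier_mat n m" unfolding H_def using G At by simp
  have AHA: "A * H * A = A"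
  proof -
    have "A * H * A = A * (H * A)" by (rule assoc_mult_mat[OF A H A])
    also have "H * A = G * B" unfolding H_def B_def by (rule assoc_mult_mat[OF G At A])
    finally show ?thesis using 1 A by simp
  qed
  have AH: "A * H \<in> carrier_mat m m" using A H by simp
  have tA: "transpose_mat (A * H) * A = A"
  proof -
    define K where "K = transpose_mat G"
    have K: "K \<in> carrier_mat n n" unfolding K_def using G by simp
    have KB: "K * B \<in> carrier_mat n n" using K B by simp
    have Bt: "transpose_mat B = B"
      unfolding B_def transpose_mult[OF At A] by (simp add: At_def)
    have "transpose_mat (B * G * B) = B" using BGB Bt by simp
    hence BKB: "B * (K * B) = B"
      unfolding transpose_mult[OF mult_carrier_mat[OF B G] B] transpose_mult[OF B G] Bt K_def .
    have Ht: "transpose_mat H = A * K"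
      unfolding H_def transpose_mult[OF G At] K_def by (simp add: At_def)
    have AK: "A * K \<in> carrier_mat m n" using A K by simp
    have "transpose_mat (A * H) * A = A * K * At * A"
      unfolding transpose_mult[OF A H] Ht At_def ..
    also have "\<dots> = A * K * B" unfolding B_def by (rule assoc_mult_mat[OF AK At A])
    also have "\<dots> = A * (K * B)" by (rule assoc_mult_mat[OF A K B])
    also have "\<dots> = A * 1\<^sub>m n"
    proof (rule gram_cancel[OF A KB one_carrier_mat], fold At_def)
      have "At * (A * (K * B)) = B * (K * B)" unfolding B_def
        by (rule assoc_mult_mat[symmetric, OF At A]) (use KB B_def in auto)
      thus "At * (A * (K * B)) = At * (A * 1\<^sub>m n)" using A BKB unfolding B_def by simp
    qed
    finally show ?thesis using A by simp
  qed
  have TH: "transpose_mat (A * H) * (A * H) = A * H"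
    using assoc_mult_mat[OF transpose_carrier_mat[THEN iffD2, OF AH] A H] tA by simp
  have "transpose_mat (transpose_mat (A * H) * (A * H)) = transpose_mat (A * H) * (A * H)"
    using transpose_mult[OF transpose_carrier_mat[THEN iffD2, OF AH] AH] by simp
  hence "transpose_mat (A * H) = A * H" unfolding TH .
  with H AHA show ?thesis by blast
qed

lemma is_pseudoinverse_exists: "\<exists>B. is_pseudoinverse A B"
proof -
  define m n where "m = dim_row A" and "n = dim_col A"
  have A: "A \<in> carrier_mat m n" unfolding m_def n_def by simp
  have At: "transpose_mat A \<in> carrier_mat n m" using A by simp
  obtain G where G: "G \<in> carrier_mat n m" and AGA: "A * G * A = A"
    and AGt: "transpose_mat (A * G) = A * G"
    using symmetric_projection_exists[OF A] by blast
  obtain K where K: "K \<in> carrier_mat m n"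
    and K1: "transpose_mat A * K * transpose_mat A = transpose_mat A"
    and K2: "transpose_mat (transpose_mat A * K) = transpose_mat A * K"
    using symmetric_projection_exists[OF At] by blast
  define H where "H = transpose_mat K"
  have H: "H \<in> carrier_mat n m" unfolding H_def using K by simp
  have HA: "H * A = transpose_mat A * K" and HAt: "transpose_mat (H * A) = H * A"
    using transpose_mult[OF At K] K2 unfolding H_def by simp_all
  have "transpose_mat (transpose_mat A * K * transpose_mat A) = A" using K1 by simp
  hence AHA: "A * (H * A) = A"
    using transpose_mult[OF mult_carrier_mat[OF At K] At] K2 HA by simp
  have AG: "A * G \<in> carrier_mat m m" and HAc: "H * A \<in> carrier_mat n n" using A G H by auto
  define B where "B = H * (A * G)"
  have B: "B \<in> carrier_mat n m" unfolding B_def using H AG by simp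
  have AB: "A * B = A * G"
  proof -
    have "B = H * A * G" unfolding B_def by (rule assoc_mult_mat[symmetric, OF H A G])
    hence "A * B = A * (H * A) * G" using assoc_mult_mat[OF A HAc G] by simp
    thus ?thesis using AHA by simp
  qed
  have BA: "B * A = H * A"
  proof -
    have "B * A = H * (A * G * A)" unfolding B_def by (rule assoc_mult_mat[OF H AG A])
    thus ?thesis using AGA by simp
  qed
  have "B * A * B = H * A * B" unfolding BA ..
  also have "\<dots> = H * (A * B)" by (rule assoc_mult_mat[OF H A B])
  also have "\<dots> = B" by (simp only: AB B_def[symmetric])
  finally have BAB: "B * A * B = B" .
  have "is_pseudoinverse A B"
    unfolding is_pseudoinverse_def BAB using B AB BA AGA AGt HAt unfolding m_def n_def by simp
  thus ?thesis ..
qed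

lemma is_pseudoinverse_unique:
  assumes B: "is_pseudoinverse A B" and C: "is_pseudoinverse A C"
  shows "B = C"
proof -
  define m n where "m = dim_row A" and "n = dim_col A"
  have A: "A \<in> carrier_mat m n" unfolding m_def n_def by simp
  have Bc: "B \<in> carrier_mat n m" and Cc: "C \<in> carrier_mat n m"
    using B C unfolding is_pseudoinverse_def m_def n_def by auto
  note b = B[unfolded is_pseudoinverse_def] and c = C[unfolded is_pseudoinverse_def]
  have AB: "A * B \<in> carrier_mat m m" and AC: "A * C \<in> carrier_mat m m"
    and BA: "B * A \<in> carrier_mat n n" and CA: "C * A \<in> carrier_mat n n" using A Bc Cc by auto
  have "A * C * (A * B) = A * B" using assoc_mult_mat[OF AC A Bc] c by simp
  hence "transpose_mat (A * C * (A * B)) = A * B" using b by simp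
  hence "A * B * (A * C) = A * B" using transpose_mult[OF AC AB] b c by simp
  moreover have "A * B * (A * C) = A * C" using assoc_mult_mat[OF AB A Cc] b by simp
  ultimately have 1: "A * B = A * C" by simp
  have "B * A * (C * A) = B * A"
    using assoc_mult_mat[OF Bc A CA] assoc_mult_mat[OF A Cc A] c by simp
  hence "transpose_mat (B * A * (C * A)) = B * A" using b by simp
  hence "C * A * (B * A) = B * A" using transpose_mult[OF BA CA] b c by simp
  moreover have "C * A * (B * A) = C * A"
    using assoc_mult_mat[OF Cc A BA] assoc_mult_mat[OF A Bc A] b by simp
  ultimately have 2: "B * A = C * A" by simp
  have "B = B * A * B" using b by simp
  also have "\<dots> = C * (A * B)" unfolding 2 by (rule assoc_mult_mat[OF Cc A Bc])
  also have "\<dots> = C * A * C" unfolding 1 by (rule assoc_mult_mat[symmetric, OF Cc A Cc])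
  also have "\<dots> = C" using c by simp
  finally show ?thesis .
qed

lemma is_pseudoinverse_pseudoinverse: "is_pseudoinverse A (pseudoinverse A)"
  unfolding pseudoinverse_def
  by (rule theI') (use is_pseudoinverse_exists is_pseudoinverse_unique in blast)

end

theory Submission
  imports Defs
begin

text \<open>Exact recovery puts the columns of \<open>X\<close> into the column space of \<open>X\<^sub>S\<close>, so the rank of
  \<open>X\<^sub>S\<close> is at least \<open>\<Sum>i. k i\<close> and a maximal linearly independent set \<open>B\<close> of columns of \<open>X\<^sub>S\<close> has
  at least that many elements. Since \<open>B\<close> is covered by the \<open>V i\<close>, and \<open>B \<inter> V i\<close> has at most \<open>k i\<close>
  elements for each \<open>i\<close>, it has exactly \<open>k i\<close> elements for each \<open>i\<close>.\<close>

lemma (in Module.module) lin_indpt_empty: "lin_indpt {}"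
  by (simp add: lin_dep_def)

text \<open>A linearly independent subset of \<open>W\<close> stays independent in \<open>V\<close>,
  so its size is at most \<open>dim\<close>. Hence a maximal one exists, is finite and is a basis of
  \<open>W\<close>.\<close>

lemma (in vectorspace) fin_dim_subspace:
  assumes fd: "fin_dim" and W: "VectorSpace.subspace K W V"
  shows "vectorspace.fin_dim K (vs W)"
proof -
  interpret W: vectorspace K "vs W" by (rule subspace_is_vs[OF W])
  have sub: "submodule K W V" using W by (rule is_module)
  hence WV: "W \<subseteq> carrier V" by (simp add: submodule_def)
  have "finite A \<and> card A \<le> dim" if A: "A \<subseteq> W \<and> W.lin_indpt A" for A
  proof -
    have "lin_indpt A" using A span_li_not_depend(2)[OF _ sub] by blast
    thus ?thesis using li_le_dim[OF fd] A WV by blast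
  qed
  moreover have "{} \<subseteq> W \<and> W.lin_indpt {}" by (simp add: W.lin_indpt_empty)
  ultimately obtain B where B: "finite B" "maximal B (\<lambda>A. A \<subseteq> W \<and> W.lin_indpt A)"
    using maximal_exists[of "\<lambda>A. A \<subseteq> W \<and> W.lin_indpt A" dim "{}"] by blast
  hence "W.basis B" by (intro W.max_li_is_basis) simp
  thus ?thesis using B(1) unfolding W.basis_def W.fin_dim_def by blast
qed

text \<open>Independence of \<open>A\<close> in \<open>V\<close> and in \<open>W\<close> agree, so
  the dimension bound inside \<open>W\<close> applies. It serves both for column spaces and for the
  single subspaces \<open>V i\<close>.\<close>

lemma (in vectorspace) card_lin_indpt_le_dim_subspace:
  assumes "fin_dim" and W: "VectorSpace.subspace K W V" and A: "A \<subseteq> W" "lin_indpt A"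
  shows "card A \<le> vectorspace.dim K (vs W)"
proof -
  interpret W: vectorspace K "vs W" by (rule subspace_is_vs[OF W])
  have "W.lin_indpt A" using A span_li_not_depend(2)[OF _ is_module[OF W]] by blast
  thus ?thesis using W.li_le_dim(2) fin_dim_subspace[OF assms(1) W] A(1) by simp
qed

text \<open>A maximal independent set of columns has size \<open>rank A\<close>. It exists because
  there are finitely many columns and the empty set is independent.\<close>

lemma (in vec_space) max_lin_indpt_cols:
  assumes A: "A \<in> carrier_mat n nc"
  obtains B where "B \<subseteq> set (cols A)" "lin_indpt B" "card B = rank A"
proof -
  let ?P = "\<lambda>T. T \<subseteq> set (cols A) \<and> lin_indpt T"
  have "\<exists>B. finite B \<and> maximal B ?P \<and> {} \<subseteq> B"
    by (rule maximal_exists_superset[OF finite_set])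
      (erule conjunct1, intro conjI empty_subsetI lin_indpt_empty)
  then obtain B where B: "maximal B ?P" by (elim exE conjE)
  hence P: "?P B" unfolding maximal_def by (rule conjunct1)
  show ?thesis using conjunct1[OF P] conjunct2[OF P] rank_card_indpt[OF A B, symmetric]
    by (rule that)
qed

text \<open>Each column of \<open>A * B\<close> is \<open>A\<close> applied to a column of
  \<open>B\<close>, hence lies in the column space of \<open>A\<close>, whose dimension is
  \<open>rank A\<close>.\<close>

lemma (in vec_space) rank_mult_le_left:
  assumes A: "A \<in> carrier_mat n k" and B: "B \<in> carrier_mat k l"
  shows "rank (A * B) \<le> rank A"
proof -
  have AB: "A * B \<in> carrier_mat n l" using A B by simp
  have colsA: "set (cols A) \<subseteq> carrier_vec n" using A cols_dim by blast
  obtain C where C: "C \<subseteq> set (cols (A * B))" "lin_indpt C" "card C = rank (A * B)"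
    by (rule max_lin_indpt_cols[OF AB])
  have "set (cols (A * B)) \<subseteq> span (set (cols A))"
  proof
    fix v assume "v \<in> set (cols (A * B))"
    then obtain j where j: "j < l" "v = col (A * B) j" using AB by (auto simp: cols_def)
    hence "v = A *\<^sub>v col B j" by (simp only: col_mult2[OF A B])
    moreover have "col B j \<in> carrier_vec (dim_col A)" "A *\<^sub>v col B j \<in> carrier_vec (dim_row A)"
      using A B by auto
    ultimately show "v \<in> span (set (cols A))"
      using col_space_eq[OF A] unfolding col_space_def by blast
  qed
  hence "C \<subseteq> span (set (cols A))" using C(1) by (rule subset_trans[rotated])
  moreover have "VectorSpace.subspace class_ring (span (set (cols A))) V"
    by (rule span_is_subspace) (simp add: colsA)
  ultimately have "card C \<le> rank A"
    unfolding rank_def using C(2) by (intro card_lin_indpt_le_dim_subspace fin_dim)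
  thus ?thesis by (simp only: C(3))
qed

lemma set_cols_select_cols: "set (cols (select_cols X S)) \<subseteq> set (cols X)"
proof
  fix v assume "v \<in> set (cols (select_cols X S))"
  then obtain j where j: "j < card {j. j < dim_col X \<and> j \<in> S}"
    and v: "v = col (select_cols X S) j"
    by (auto simp: cols_def select_cols_def dim_submatrix)
  \<comment> \<open>\<open>pick S j\<close> is the element of \<open>S\<close> at position
    \<open>j\<close> in increasing order, counted from 0: the index in \<open>X\<close> of the
    selected column \<open>j\<close>.\<close>
  have "v = col X (pick S j)"
    using j pick_le[OF j] unfolding v select_cols_def
    by (intro eq_vecI) (auto simp: dim_submatrix submatrix_index pick_UNIV)
  moreover have "pick S j < dim_col X" by (rule pick_le[OF j])
  ultimately show "v \<in> set (cols X)" by (auto simp: cols_def)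
qed

theorem mainTheorem2:
  fixes m N p :: nat
    and V :: "nat \<Rightarrow> real vec set"
    and k :: "nat \<Rightarrow> nat"
    and X :: "real mat"
    and S :: "nat set"
  assumes subspaces: "\<And>i. i \<in> {1..p} \<Longrightarrow> is_subspace m (V i)"
    and dims: "\<And>i. i \<in> {1..p} \<Longrightarrow> subspace_dim m (V i) = k i"
    and X: "X \<in> carrier_mat m N"
    and cols_X: "set (cols X) \<subseteq> subspace_union p V"
    and indep: "independent_subspaces m p V"
    and rank_X: "vec_space.rank m X = (\<Sum>i\<in>{1..p}. k i)"
    and S: "S \<subseteq> {0..<N}"
    and recovery: "X = select_cols X S * pseudoinverse (select_cols X S) * X"
  shows "complete_reference_set m p V (select_cols X S)"
proof -
  interpret vec_space "TYPE(real)" m .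
  define Y where "Y = select_cols X S"
  define P where "P = pseudoinverse Y"
  have Y: "Y \<in> carrier_mat m (dim_col Y)"
    using X by (auto simp: Y_def select_cols_def dim_submatrix)
  have "P \<in> carrier_mat (dim_col Y) (dim_row Y)"
    using is_pseudoinverse_pseudoinverse unfolding is_pseudoinverse_def P_def by blast
  hence P: "P \<in> carrier_mat (dim_col Y) m" unfolding carrier_matD(1)[OF Y] .
  \<comment> \<open>Reassociating exposes \<open>Y\<close> as a left factor of \<open>X\<close>,
    which bounds \<open>rank X\<close> by \<open>rank Y\<close>.\<close>
  have "X = Y * (P * X)"
    using recovery unfolding assoc_mult_mat[OF Y P X, unfolded Y_def P_def] Y_def P_def .
  hence rank_le: "rank X \<le> rank Y"
    using rank_mult_le_left[OF Y mult_carrier_mat[OF P X]] by metis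
  have cols_Y: "set (cols Y) \<subseteq> subspace_union p V"
    using set_cols_select_cols cols_X unfolding Y_def by blast
  obtain B where B: "B \<subseteq> set (cols Y)" "lin_indpt B" "card B = rank Y"
    by (rule max_lin_indpt_cols[OF Y])
  have finB: "finite B" using B(1) by (rule finite_subset) simp
  have le: "card (B \<inter> V i) \<le> k i" if i: "i \<in> {1..p}" for i
    using card_lin_indpt_le_dim_subspace[OF fin_dim subspaces[OF i], of "B \<inter> V i"]
      subset_li_is_li[OF B(2)] dims[OF i] by simp
  \<comment> \<open>The union bound turns this cover into a lower bound on the sum of the sizes of
    the pieces.\<close>
  have "B = (\<Union>i\<in>{1..p}. B \<inter> V i)" using B(1) cols_Y unfolding subspace_union_def by blast
  hence "card B \<le> (\<Sum>i\<in>{1..p}. card (B \<inter> V i))"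
    using card_UN_le[of "{1..p}"] by (metis finite_atLeastAtMost)
  hence sum_le: "(\<Sum>i\<in>{1..p}. k i) \<le> (\<Sum>i\<in>{1..p}. card (B \<inter> V i))"
    using rank_X rank_le B(3) by simp
  \<comment> \<open>If one of the bounds in \<open>le\<close> were strict, summing all of them would
    contradict \<open>sum_le\<close>.\<close>
  have eq: "card (B \<inter> V i) = k i" if i: "i \<in> {1..p}" for i
  proof (rule ccontr)
    assume "card (B \<inter> V i) \<noteq> k i"
    hence "(\<Sum>i\<in>{1..p}. card (B \<inter> V i)) < (\<Sum>i\<in>{1..p}. k i)"
      using le i by (intro sum_strict_mono_ex1) (auto intro!: bexI[of _ i] simp: order_less_le)
    thus False using sum_le by simp
  qed
  have "\<exists>J \<subseteq> {0..<dim_col Y}. subspace_dim m (V i) \<le> card J \<and> inj_on (col Y) J \<and>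
      linearly_independent m (col Y ` J) \<and> col Y ` J \<subseteq> V i" if i: "i \<in> {1..p}" for i
  proof -
    have "B \<inter> V i \<subseteq> col Y ` {0..<dim_col Y}" using B(1) by (auto simp: cols_def)
    \<comment> \<open>\<open>B\<close> is a set of vectors, while the goal asks for column indices.
      \<open>J\<close> takes exactly one index for each vector of \<open>B \<inter> V i\<close>, so
      a repeated column of \<open>Y\<close> enters once and \<open>card J\<close> is still
      \<open>k i\<close>.\<close>
    then obtain J where J: "J \<subseteq> {0..<dim_col Y}" "inj_on (col Y) J" "B \<inter> V i = col Y ` J"
      by (auto simp: subset_image_inj)
    have "card J = k i" using card_image[OF J(2)] eq[OF i] J(3) by simp
    moreover have "lin_indpt (col Y ` J)" using subset_li_is_li[OF B(2)] J(3) by blast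
    ultimately show ?thesis using J dims[OF i] by (intro exI[of _ J]) auto
  qed
  thus ?thesis using cols_Y unfolding complete_reference_set_def Y_def by blast
qed

end
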